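(* Let $m\ge 2$ and, for $i=1,\dots,m$, let $A_i\in\mathbb{R}^{n_i\times n_i}$ be given and let $\Delta A_i\in\mathbb{R}^{n_i\times n_i}$ be an uncertain matrix ranging over a set $\mathcal{D}_i\subseteq\mathbb{R}^{n_i\times n_i}$ of admissible uncertainties. Let $B_1\in\mathbb{R}^{n_1\times p_1}$ and consider the dynamics $$\dot{\mathbf{x}}(t)=\big(A_\oplus+\Delta A_\oplus\big)\mathbf{x}(t)+B_\otimes\mathbf{u}(t),\qquad \mathbf{x}(0)=\mathbf{x}_0,$$ where $A_\oplus=A_1\oplus\cdots\oplus A_m$, $\Delta A_\oplus=\Delta A_1\oplus\cdots\oplus\Delta A_m$ and $B_\otimes=B_1\otimes I_{n_2}\otimes\cdots\otimes I_{n_m}$. Let $Q_1\in\mathbb{R}^{n_1\times n_1}$ with $Q_1\succeq 0$, let $R_1\in\mathbb{R}^{p_1\times p_1}$ with $R_1\succ 0$, and let $\mathcal{U}_1$ be a symmetric positive matrix-valued function such that $$\Delta A_1^{\top}\bar P+\bar P\,\Delta A_1\preceq \mathcal{U}_1(\bar P)\quad\text{for all } \bar P\succ 0 \text{ and all } \Delta A_1\in\mathcal{D}_1 .$$ Let $P_1\succ 0$ be a solution of $$A_1^{\top}P_1+P_1A_1+Q_1-P_1B_1R_1^{-1}B_1^{\top}P_1+\mathcal{U}_1(P_1)=0,$$ and set $K_1=R_1^{-1}B_1^{\top}P_1$. For $i=2,\dots,m$ let $M_i\in\mathbb{R}^{n_i\times n_i}$, $M_i\succ 0$, be such that $$F_i:=A_i^{\top}M_i+M_iA_i\preceq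 0\qquad\text{and}\qquad G_i:=\Delta A_i^{\top}M_i+M_i\Delta A_i\prec 0\ \text{ for all }\Delta A_i\in\mathcal{D}_i .$$ Define $$P_\otimes=P_1\otimes M_2\otimes\cdots\otimes M_m,\qquad R_\otimes=R_1\otimes M_2\otimes\cdots\otimes M_m,$$ $$Q_\otimes=Q_1\otimes M_2\otimes\cdots\otimes M_m-P_1\otimes\Big(\sum_{i=2}^m M_2\otimes\cdots\otimes M_{i-1}\otimes F_i\otimes M_{i+1}\otimes\cdots\otimes M_m\Big).$$ Then, for every $\Delta A_i\in\mathcal{D}_i$ ($i=1,\dots,m$) and every initial state $\mathbf{x}_0$, the state-feedback control law $\mathbf{u}=-K_\otimes\mathbf{x}$ with $K_\otimes=K_1\otimes I_{n_2}\otimes\cdots\otimes I_{n_m}$ yields $$\bar J=\int_0^\infty\big(\mathbf{x}^{\top}Q_\otimes\mathbf{x}+\mathbf{u}^{\top}R_\otimes\mathbf{u}\big)\,dt\ \le\ \mathbf{x}_0^{\top}P_\otimes\mathbf{x}_0 .$$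
   Context: All matrices are real. $I_n$ is the $n\times n$ identity matrix, $\otimes$ is the Kronecker product, and the Kronecker sum of square matrices $M\in\mathbb{R}^{p\times p}$, $N\in\mathbb{R}^{q\times q}$ is $M\oplus N=M\otimes I_q+I_p\otimes N$; it is iterated for more than two matrices, so that $A_1\oplus\cdots\oplus A_m=\sum_{i=1}^m I_{n_1}\otimes\cdots\otimes I_{n_{i-1}}\otimes A_i\otimes I_{n_{i+1}}\otimes\cdots\otimes I_{n_m}$. The notation $N\succ 0$ (resp. $N\succeq 0$) means that $N$ is symmetric positive definite (resp. symmetric positive semidefinite); for symmetric matrices $A,B$, $A\preceq B$ means $B-A\succeq 0$, and $N\prec 0$, $N\preceq 0$ mean $-N\succ 0$, $-N\succeq 0$. A symmetric positive matrix-valued function $\mathcal{U}_1$ assigns to each $n_1\times n_1$ matrix $P\succ 0$ an $n_1\times n_1$ symmetric positive semidefinite matrix $\mathcal{U}_1(P)$. The state $\mathbf{x}(t)$ lies in $\mathbb{R}^{n_1n_2\cdots n_m}$ and the input $\mathbf{u}(t)$ in $\mathbb{R}^{p_1n_2\cdots n_m}$. The uncertainties $\Delta A_i$ are constant in time. *)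

theory Defs
  imports
    "HOL-Analysis.Interval_Integral"
    "Jordan_Normal_Form.Matrix"
    "Jordan_Normal_Form.Gauss_Jordan_Elimination"
begin

unbundle no inner_syntax
unbundle no vec_syntax

definition mat_inv :: "real mat \<Rightarrow> real mat" where
  "mat_inv A = the (mat_inverse A)"

definition kron :: "real mat \<Rightarrow> real mat \<Rightarrow> real mat" where
  "kron A B = mat (dim_row A * dim_row B) (dim_col A * dim_col B)
     (\<lambda>(i, j). A $$ (i div dim_row B, j div dim_col B) * B $$ (i mod dim_row B, j mod dim_col B))"

definition kron_sum :: "real mat \<Rightarrow> real mat \<Rightarrow> real mat" where
  "kron_sum M N = kron M (1\<^sub>m (dim_row N)) + kron (1\<^sub>m (dim_row M)) N"

(* The values on the empty list are the neutral elements of the two operations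
   (see kron_one_right and kron_sum_zero_right). *)

definition kron_list :: "real mat list \<Rightarrow> real mat" where
  "kron_list As = foldr kron As (1\<^sub>m 1)"

definition kron_sum_list :: "real mat list \<Rightarrow> real mat" where
  "kron_sum_list As = foldr kron_sum As (0\<^sub>m 1 1)"

lemma kron_one_right [simp]: "kron A (1\<^sub>m 1) = A"
  by (rule eq_matI) (auto simp: kron_def)

lemma kron_sum_zero_right: "A \<in> carrier_mat k k \<Longrightarrow> kron_sum A (0\<^sub>m 1 1) = A"
  by (rule eq_matI) (auto simp: kron_sum_def kron_def)

definition mat_sum_list :: "nat \<Rightarrow> nat \<Rightarrow> real mat list \<Rightarrow> real mat" where
  "mat_sum_list r c As = foldr (+) As (0\<^sub>m r c)"

definition quad_form :: "real mat \<Rightarrow> real Matrix.vec \<Rightarrow> real" where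
  "quad_form A v = v \<bullet> (A *\<^sub>v v)"

definition sym_mat :: "nat \<Rightarrow> real mat \<Rightarrow> bool" where
  "sym_mat k N \<longleftrightarrow> N \<in> carrier_mat k k \<and> N\<^sup>T = N"

definition pos_semidef :: "nat \<Rightarrow> real mat \<Rightarrow> bool" where
  "pos_semidef k N \<longleftrightarrow> sym_mat k N \<and> (\<forall>v \<in> carrier_vec k. quad_form N v \<ge> 0)"

definition pos_def :: "nat \<Rightarrow> real mat \<Rightarrow> bool" where
  "pos_def k N \<longleftrightarrow> sym_mat k N \<and> (\<forall>v \<in> carrier_vec k. v \<noteq> 0\<^sub>v k \<longrightarrow> quad_form N v > 0)"

definition neg_semidef :: "nat \<Rightarrow> real mat \<Rightarrow> bool" where
  "neg_semidef k N \<longleftrightarrow> pos_semidef k (- N)"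

definition neg_def :: "nat \<Rightarrow> real mat \<Rightarrow> bool" where
  "neg_def k N \<longleftrightarrow> pos_def k (- N)"

definition loewner_le :: "nat \<Rightarrow> real mat \<Rightarrow> real mat \<Rightarrow> bool" where
  "loewner_le k A B \<longleftrightarrow> sym_mat k A \<and> sym_mat k B \<and> pos_semidef k (B - A)"

(* x is a classical solution on [0, infinity) of x' = A x + B u with x(0) = x0.
   The type of vectors carries no topology, so the derivative is taken componentwise;
   it is one-sided at t = 0. *)
definition lti_solution ::
  "real mat \<Rightarrow> real mat \<Rightarrow> (real \<Rightarrow> real Matrix.vec) \<Rightarrow> real Matrix.vec \<Rightarrow> (real \<Rightarrow> real Matrix.vec) \<Rightarrow> bool" where
  "lti_solution A B u x0 x \<longleftrightarrow> x 0 = x0 \<and>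
     (\<forall>t\<ge>0. x t \<in> carrier_vec (dim_row A) \<and> u t \<in> carrier_vec (dim_col B) \<and>
       (\<forall>k < dim_row A. ((\<lambda>s. vec_index (x s) k) has_real_derivative
          vec_index (A *\<^sub>v x t + B *\<^sub>v u t) k) (at t within {0..})))"

end

theory Submission
  imports Defs "Jordan_Normal_Form.Determinant"
begin

text \<open>
  The function \<open>V x = x\<^sup>T P_kron x\<close> is a storage function for the closed loop. Along
  every solution it satisfies the dissipation inequality
  \<open>V' + x\<^sup>T Q_kron x + u\<^sup>T R_kron u \<le> 0\<close>; since \<open>V\<close> and the running cost are nonnegative,
  integrating from \<open>0\<close> to \<open>T\<close> bounds the accumulated cost by \<open>V (x 0)\<close> for every \<open>T\<close>, and
  monotone convergence turns this into integrability over the half-line with the same bound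
  (\<open>dissipation_inequality_integral\<close>, \<open>state_feedback_cost_bound\<close>). The running cost is
  nonnegative because the sum of Kronecker products subtracted in \<open>Q_kron\<close> is negative
  semidefinite, a consequence of \<open>F\<^sub>i \<preceq> 0\<close>.

  The dissipation inequality is an inequality between matrices. Let
  \<open>lyap X P = X\<^sup>T P + P X\<close>, the matrix that represents the derivative of \<open>x\<^sup>T P x\<close> along
  \<open>x' = X x\<close>. The mixed-product property of the Kronecker product gives
  \<open>lyap (X \<oplus> T) (P \<otimes> N) = lyap X P \<otimes> N + P \<otimes> lyap T N\<close> (\<open>lyap_kron_sum\<close>), and
  the closed loop is itself a Kronecker sum, because the feedback acts on the first factor only.
  With \<open>N = M\<^sub>2 \<otimes> \<dots> \<otimes> M\<^sub>m\<close>, with \<open>T\<close> and \<open>T'\<close> the Kronecker sums of the matrices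
  \<open>A\<^sub>i\<close> and \<open>\<Delta>A\<^sub>i\<close> for \<open>i \<ge> 2\<close>, the problem splits into two parts.

  On the first factor, the Riccati equation turns the closed-loop expression into
  \<open>lyap \<Delta>A\<^sub>1 P\<^sub>1 - U\<^sub>1 P\<^sub>1\<close>, which is negative semidefinite by the choice of \<open>U\<^sub>1\<close>
  (\<open>riccati_closed_loop\<close>). On the remaining factors, the sum subtracted in \<open>Q_kron\<close> is
  exactly \<open>P\<^sub>1 \<otimes> lyap T N\<close> (\<open>lyap_kron_list\<close>), so it cancels and leaves
  \<open>P\<^sub>1 \<otimes> lyap T' N\<close>, which is negative semidefinite because each
  \<open>lyap \<Delta>A\<^sub>i M\<^sub>i\<close> is (\<open>neg_semidef_lyap_kron_list\<close>). What makes all sign statements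
  pass to Kronecker products is that these preserve positive semidefiniteness
  (\<open>pos_semidef_kron\<close>).
\<close>

section \<open>Gram decomposition of positive semidefinite kernels\<close>

text \<open>
  The induction splits off the last index: if the
  last diagonal entry is positive, the Schur complement \<open>?b\<close> of that entry is again positive
  semidefinite and the difference is a rank-one kernel; if it vanishes, semidefiniteness forces the
  whole last row to vanish. Since \<open>x / 0 = 0\<close>, one formula covers both cases.
\<close>

lemma gram_decomposition:
  fixes a :: "nat \<Rightarrow> nat \<Rightarrow> real"
  assumes "\<And>i j. i < n \<Longrightarrow> j < n \<Longrightarrow> a i j = a j i"
    and "\<And>v. 0 \<le> (\<Sum>i<n. \<Sum>j<n. a i j * v i * v j)"
  shows "\<exists>w. \<forall>i<n. \<forall>j<n. a i j = (\<Sum>r<n. w r i * w r j)"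
  using assms
proof (induction n arbitrary: a)
  case (Suc n)
  let ?d = "a n n"
  have sym: "a i n = a n i" if "i < n" for i using Suc.prems(1) that by simp
  have split: "(\<Sum>i<Suc n. \<Sum>j<Suc n. a i j * v i * v j) =
      (\<Sum>i<n. \<Sum>j<n. a i j * v i * v j) + 2 * v n * (\<Sum>i<n. a i n * v i) + ?d * (v n)\<^sup>2" for v
  proof -
    have "(\<Sum>j<n. a n j * v n * v j) = v n * (\<Sum>i<n. a i n * v i)"
      unfolding sum_distrib_left by (intro sum.cong refl) (simp add: sym)
    moreover have "(\<Sum>i<n. a i n * v i * v n) = v n * (\<Sum>i<n. a i n * v i)"
      by (simp add: sum_distrib_left mult.commute cong: sum.cong)
    ultimately show ?thesis
      by (simp add: sum.distrib power2_eq_square)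
  qed
  have d0: "0 \<le> ?d"
    using Suc.prems(2)[of "\<lambda>i. if i = n then 1 else 0"] unfolding split by simp
  have zero: "a i n = 0" if d: "?d = 0" and i: "i < n" for i
  proof (rule ccontr)
    assume nz: "a i n \<noteq> 0"
    let ?v = "\<lambda>t j. if j = n then t else if j = i then 1 else (0::real)"
    have "0 \<le> a i i + 2 * t * a i n" for t
    proof -
      have "(\<Sum>k<n. \<Sum>j<n. a k j * ?v t k * ?v t j) = (\<Sum>k<n. \<Sum>j<n. if j = i then (if k = i then a i i else 0) else 0)"
        by (intro sum.cong refl) auto
      moreover have "(\<Sum>k<n. a k n * ?v t k) = (\<Sum>k<n. if k = i then a i n else 0)"
        by (intro sum.cong refl) auto
      ultimately show ?thesis
        using Suc.prems(2)[of "?v t"] d i unfolding split by (simp add: algebra_simps)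
    qed
    \<comment> \<open>This value of \<open>t\<close> makes the affine expression equal to \<open>- 1\<close>.\<close>
    from this[of "- (a i i + 1) / (2 * a i n)"] nz show False by (simp add: field_simps)
  qed
  let ?b = "\<lambda>i j. a i j - a i n * a j n / ?d"
  have "\<exists>w. \<forall>i<n. \<forall>j<n. ?b i j = (\<Sum>r<n. w r i * w r j)"
  proof (rule Suc.IH)
    show "?b i j = ?b j i" if "i < n" "j < n" for i j
      using Suc.prems(1) that by (simp add: mult.commute)
    fix v :: "nat \<Rightarrow> real"
    let ?s = "\<Sum>i<n. a i n * v i"
    \<comment> \<open>Extend \<open>v\<close> by the last coordinate that minimises the form; the minimum is the form of \<open>?b\<close> at \<open>v\<close>.\<close>
    let ?u = "v(n := - ?s / ?d)"
    have sq: "?s\<^sup>2 = (\<Sum>i<n. \<Sum>j<n. a i n * a j n * v i * v j)"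
      unfolding power2_eq_square sum_product by (simp add: algebra_simps)
    have e: "(\<Sum>i<n. \<Sum>j<n. ?b i j * v i * v j) = (\<Sum>i<n. \<Sum>j<n. a i j * v i * v j) - ?s\<^sup>2 / ?d"
      unfolding sq by (simp add: left_diff_distrib sum_subtractf sum_divide_distrib)
    have "0 \<le> (\<Sum>i<Suc n. \<Sum>j<Suc n. a i j * ?u i * ?u j)" by (rule Suc.prems(2))
    also have "\<dots> = (\<Sum>i<n. \<Sum>j<n. a i j * v i * v j) - ?s\<^sup>2 / ?d"
      unfolding split by (cases "?d = 0") (simp_all add: field_simps power2_eq_square)
    finally show "0 \<le> (\<Sum>i<n. \<Sum>j<n. ?b i j * v i * v j)" unfolding e .
  qed
  then obtain w where w: "\<And>i j. i < n \<Longrightarrow> j < n \<Longrightarrow> ?b i j = (\<Sum>r<n. w r i * w r j)" by blast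
  let ?w = "\<lambda>r i. if r = n then a i n / sqrt ?d else if i = n then 0 else w r i"
  have "a i j = (\<Sum>r<Suc n. ?w r i * ?w r j)" if ij: "i < Suc n" "j < Suc n" for i j
  proof -
    have last: "?w n i * ?w n j = a i n * a j n / ?d"
      using d0 by simp
    have "(\<Sum>r<n. ?w r i * ?w r j) = a i j - a i n * a j n / ?d"
    proof (cases "i = n \<or> j = n")
      case True
      then have "(\<Sum>r<n. ?w r i * ?w r j) = 0" by (intro sum.neutral) auto
      then show ?thesis using True zero sym ij by (cases "?d = 0") (auto simp: less_Suc_eq)
    next
      case False
      then have "(\<Sum>r<n. ?w r i * ?w r j) = (\<Sum>r<n. w r i * w r j)" by (intro sum.cong) auto
      then show ?thesis using w[of i j] False ij by simp
    qed
    then show ?thesis using last by simp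
  qed
  then show ?case by (intro exI[of _ ?w] allI impI)
qed simp

section \<open>Positive semidefinite Kronecker products\<close>

lemma sum_lessThan_mult:
  fixes f :: "nat \<Rightarrow> 'a::comm_monoid_add"
  shows "(\<Sum>a<p * q. f a) = (\<Sum>i<p. \<Sum>k<q. f (i * q + k))"
proof (induction p)
  case (Suc p)
  have "(\<Sum>a<Suc p * q. f a) = (\<Sum>a<p * q + q. f a)"
    by (simp add: add.commute)
  also have "\<dots> = (\<Sum>a<p * q. f a) + (\<Sum>k<q. f (p * q + k))"
    using sum.atLeastLessThan_concat[of 0 "p * q" "p * q + q" f] sum.shift_bounds_nat_ivl[of f 0 "p * q" q]
    by (simp add: lessThan_atLeast0 add.commute)
  finally show ?case using Suc by simp
qed simp

lemma kron_carrier [simp]: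
  "A \<in> carrier_mat a b \<Longrightarrow> B \<in> carrier_mat c d \<Longrightarrow> kron A B \<in> carrier_mat (a * c) (b * d)"
  by (auto simp: kron_def)

lemma bilinear_form_sum:
  fixes A :: "real mat"
  assumes "A \<in> carrier_mat k k" "v \<in> carrier_vec k" "w \<in> carrier_vec k"
  shows "v \<bullet> (A *\<^sub>v w) = (\<Sum>i<k. \<Sum>j<k. A $$ (i, j) * v $ i * w $ j)"
proof -
  have "v \<bullet> (A *\<^sub>v w) = (\<Sum>i<k. v $ i * (\<Sum>j<k. A $$ (i, j) * w $ j))"
    using assms by (simp add: scalar_prod_def lessThan_atLeast0)
  then show ?thesis by (simp add: sum_distrib_left ac_simps)
qed

lemma quad_form_sum:
  assumes "A \<in> carrier_mat k k" "v \<in> carrier_vec k"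
  shows "quad_form A v = (\<Sum>i<k. \<Sum>j<k. A $$ (i, j) * v $ i * v $ j)"
  unfolding quad_form_def by (rule bilinear_form_sum[OF assms assms(2)])

lemma div_mod_bounds:
  assumes "i < a * (b::nat)"
  shows "i div b < a" "i mod b < b"
  using assms by (auto simp: less_mult_imp_div_less mult.commute)
   (metis gr_implies_not0 mod_less_divisor mult_0_right neq0_conv)

lemma kron_index:
  assumes "A \<in> carrier_mat a b" "B \<in> carrier_mat c d" "i < a * c" "j < b * d"
  shows "kron A B $$ (i, j) = A $$ (i div c, j div d) * B $$ (i mod c, j mod d)"
  using assms by (auto simp: kron_def)

lemma kron_transpose:
  "(kron A B)\<^sup>T = kron A\<^sup>T B\<^sup>T"
  unfolding kron_def by (rule eq_matI) (simp_all add: div_mod_bounds)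

lemma pos_semidef_carrier: "pos_semidef k A \<Longrightarrow> A \<in> carrier_mat k k"
  by (simp add: pos_semidef_def sym_mat_def)

lemma gram_bilinear:
  fixes w :: "nat \<Rightarrow> nat \<Rightarrow> real"
  shows "(\<Sum>i<p. \<Sum>j<p. (\<Sum>r<m. w r i * w r j) * a i * b j) =
    (\<Sum>r<m. (\<Sum>i<p. w r i * a i) * (\<Sum>j<p. w r j * b j))"
proof -
  have "(\<Sum>i<p. \<Sum>j<p. (\<Sum>r<m. w r i * w r j) * a i * b j) =
      (\<Sum>i<p. \<Sum>j<p. \<Sum>r<m. (w r i * a i) * (w r j * b j))"
    by (intro sum.cong refl) (simp add: sum_distrib_right mult.assoc mult.left_commute)
  also have "\<dots> = (\<Sum>i<p. \<Sum>r<m. \<Sum>j<p. (w r i * a i) * (w r j * b j))"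
    by (rule sum.cong[OF refl], rule sum.swap)
  also have "\<dots> = (\<Sum>r<m. \<Sum>i<p. \<Sum>j<p. (w r i * a i) * (w r j * b j))"
    by (rule sum.swap)
  finally show ?thesis by (simp add: sum_product)
qed

text \<open>
  Read a vector \<open>v\<close> of length \<open>p * q\<close> as a \<open>p\<close> by \<open>q\<close> array. Writing \<open>A\<close> as a sum of
  rank-one matrices \<open>w\<^sub>r w\<^sub>r\<^sup>T\<close>, the form of \<open>A \<otimes> B\<close> at \<open>v\<close> becomes the sum over \<open>r\<close> of the
  forms of \<open>B\<close> at the contractions of the array with \<open>w\<^sub>r\<close>, each of which is nonnegative.
\<close>

lemma pos_semidef_kron:
  assumes A: "pos_semidef p A" and B: "pos_semidef q B"
  shows "pos_semidef (p * q) (kron A B)"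
proof -
  have cA: "A \<in> carrier_mat p p" "A\<^sup>T = A" and cB: "B \<in> carrier_mat q q" "B\<^sup>T = B"
    using A B by (auto simp: pos_semidef_def sym_mat_def)
  have "\<exists>w. \<forall>i<p. \<forall>j<p. A $$ (i, j) = (\<Sum>r<p. w r i * w r j)"
  proof (rule gram_decomposition)
    show "A $$ (i, j) = A $$ (j, i)" if "i < p" "j < p" for i j
      using cA that by (metis carrier_matD index_transpose_mat(1))
    show "0 \<le> (\<Sum>i<p. \<Sum>j<p. A $$ (i, j) * v i * v j)" for v
      using A quad_form_sum[OF cA(1), of "vec p v"] by (simp add: pos_semidef_def) (metis vec_carrier)
  qed
  then obtain w where w: "\<And>i j. i < p \<Longrightarrow> j < p \<Longrightarrow> A $$ (i, j) = (\<Sum>r<p. w r i * w r j)" by blast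
  have "0 \<le> quad_form (kron A B) v" if v: "v \<in> carrier_vec (p * q)" for v
  proof -
    let ?y = "\<lambda>r k. \<Sum>i<p. w r i * v $ (i * q + k)"
    have bound: "i * q + k < p * q" if "i < p" "k < q" for i k
    proof -
      have "i * q + k < Suc i * q" using that by simp
      also have "\<dots> \<le> p * q" using that by (intro mult_le_mono1) simp
      finally show ?thesis .
    qed
    have "quad_form (kron A B) v = (\<Sum>i<p. \<Sum>k<q. \<Sum>j<p. \<Sum>l<q.
        A $$ (i, j) * B $$ (k, l) * v $ (i * q + k) * v $ (j * q + l))"
      unfolding quad_form_sum[OF kron_carrier[OF cA(1) cB(1)] v] sum_lessThan_mult
      by (intro sum.cong refl) (simp add: kron_index[OF cA(1) cB(1)] bound)
    also have "\<dots> = (\<Sum>k<q. \<Sum>i<p. \<Sum>j<p. \<Sum>l<q.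
        A $$ (i, j) * B $$ (k, l) * v $ (i * q + k) * v $ (j * q + l))"
      by (rule sum.swap)
    also have "\<dots> = (\<Sum>k<q. \<Sum>i<p. \<Sum>l<q. \<Sum>j<p.
        A $$ (i, j) * B $$ (k, l) * v $ (i * q + k) * v $ (j * q + l))"
      by (rule sum.cong[OF refl], rule sum.cong[OF refl], rule sum.swap)
    also have "\<dots> = (\<Sum>k<q. \<Sum>l<q. \<Sum>i<p. \<Sum>j<p.
        A $$ (i, j) * B $$ (k, l) * v $ (i * q + k) * v $ (j * q + l))"
      by (rule sum.cong[OF refl], rule sum.swap)
    also have "\<dots> = (\<Sum>k<q. \<Sum>l<q. B $$ (k, l) *
        (\<Sum>i<p. \<Sum>j<p. (\<Sum>r<p. w r i * w r j) * v $ (i * q + k) * v $ (j * q + l)))"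
      by (intro sum.cong refl) (simp add: w sum_distrib_left mult.assoc mult.left_commute)
    also have "\<dots> = (\<Sum>k<q. \<Sum>l<q. \<Sum>r<p. B $$ (k, l) * ?y r k * ?y r l)"
    proof -
      have dist: "c * (\<Sum>r<p. a r * b r) = (\<Sum>r<p. c * a r * b r)" for c :: real and a b
        by (simp add: sum_distrib_left mult.assoc)
      show ?thesis
        unfolding gram_bilinear by (intro sum.cong[OF refl]) (rule dist)
    qed
    also have "\<dots> = (\<Sum>k<q. \<Sum>r<p. \<Sum>l<q. B $$ (k, l) * ?y r k * ?y r l)"
      by (rule sum.cong[OF refl], rule sum.swap)
    also have "\<dots> = (\<Sum>r<p. \<Sum>k<q. \<Sum>l<q. B $$ (k, l) * ?y r k * ?y r l)"
      by (rule sum.swap)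
    also have "\<dots> = (\<Sum>r<p. quad_form B (vec q (?y r)))"
      by (simp add: quad_form_sum[OF cB(1)])
    also have "\<dots> \<ge> 0"
      using B by (intro sum_nonneg) (simp add: pos_semidef_def)
    finally show ?thesis .
  qed
  then show ?thesis
    using cA cB by (simp add: pos_semidef_def sym_mat_def kron_transpose)
qed

section \<open>Algebra of the Kronecker product\<close>

text \<open>
  The hypotheses mention only dimensions, so that the simplifier can discharge them and use the
  two rules to bring long products into a normal form.
\<close>

lemma mult_assoc_dim:
  fixes A B C :: "real mat"
  assumes "dim_col A = dim_row B" "dim_col B = dim_row C"
  shows "A * B * C = A * (B * C)"
  using assms by (intro assoc_mult_mat[of _ "dim_row A" "dim_row B" _ "dim_row C" _ "dim_col C"]) auto

lemma transpose_mult_dim: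
  fixes A B :: "real mat"
  assumes "dim_col A = dim_row B"
  shows "(A * B)\<^sup>T = B\<^sup>T * A\<^sup>T"
  using assms by (intro transpose_mult[of _ "dim_row A" "dim_row B" _ "dim_col B"]) auto

lemma mult_index:
  assumes "A \<in> carrier_mat a b" "B \<in> carrier_mat b c" "i < a" "j < c"
  shows "(A * B) $$ (i, j) = (\<Sum>k<b. A $$ (i, k) * B $$ (k, j))"
  using assms by (auto simp: scalar_prod_def lessThan_atLeast0)

text \<open>
  The mixed-product property: the sum over the inner index \<open>s * e + t\<close> factors into a sum over
  \<open>s\<close> and a sum over \<open>t\<close>.
\<close>

lemma kron_mult:
  assumes A: "A \<in> carrier_mat a b" and C: "C \<in> carrier_mat b c"
    and B: "B \<in> carrier_mat d e" and D: "D \<in> carrier_mat e f"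
  shows "kron A B * kron C D = kron (A * C) (B * D)"
proof (rule eq_matI)
  note AB = kron_carrier[OF A B] and CD = kron_carrier[OF C D]
  have AC: "A * C \<in> carrier_mat a c" and BD: "B * D \<in> carrier_mat d f" using A B C D by auto
  note ACBD = kron_carrier[OF AC BD]
  show "dim_row (kron A B * kron C D) = dim_row (kron (A * C) (B * D))"
    "dim_col (kron A B * kron C D) = dim_col (kron (A * C) (B * D))"
    using AB CD ACBD by auto
  fix i j assume "i < dim_row (kron (A * C) (B * D))" "j < dim_col (kron (A * C) (B * D))"
  then have i: "i < a * d" and j: "j < c * f" using ACBD by auto
  have bound: "s * e + t < b * e" if "s < b" "t < e" for s t
  proof -
    have "s * e + t < Suc s * e" using that by simp
    also have "\<dots> \<le> b * e" using that by (intro mult_le_mono1) simp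
    finally show ?thesis .
  qed
  have "(kron A B * kron C D) $$ (i, j) = (\<Sum>s<b. \<Sum>t<e.
      (A $$ (i div d, s) * C $$ (s, j div f)) * (B $$ (i mod d, t) * D $$ (t, j mod f)))"
    unfolding mult_index[OF AB CD i j] sum_lessThan_mult
    by (intro sum.cong refl) (simp add: kron_index[OF A B] kron_index[OF C D] i j bound)
  also have "\<dots> = kron (A * C) (B * D) $$ (i, j)"
    unfolding kron_index[OF AC BD i j]
    by (simp add: mult_index[OF A C] mult_index[OF B D] div_mod_bounds[OF i] div_mod_bounds[OF j] sum_product)
  finally show "(kron A B * kron C D) $$ (i, j) = kron (A * C) (B * D) $$ (i, j)" .
qed

lemma kron_add_left:
  assumes "A \<in> carrier_mat a b" "A' \<in> carrier_mat a b" "B \<in> carrier_mat c d"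
  shows "kron (A + A') B = kron A B + kron A' B"
  using assms by (intro eq_matI) (auto simp: kron_def div_mod_bounds algebra_simps)

lemma kron_add_right:
  assumes A: "A \<in> carrier_mat a b" and B: "B \<in> carrier_mat c d" "B' \<in> carrier_mat c d"
  shows "kron A (B + B') = kron A B + kron A B'"
proof (rule eq_matI)
  fix i j assume "i < dim_row (kron A B + kron A B')" "j < dim_col (kron A B + kron A B')"
  then have ij: "i < a * c" "j < b * d" using kron_carrier[OF A B(2)] by auto
  note bounds = div_mod_bounds[OF ij(1)] div_mod_bounds[OF ij(2)]
  show "kron A (B + B') $$ (i, j) = (kron A B + kron A B') $$ (i, j)"
    using ij bounds A B by (simp add: kron_def algebra_simps)
qed (use A B in \<open>auto simp: kron_def\<close>)

lemma kron_uminus: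
  "kron (- A) B = - kron A B" "kron A (- B) = - kron A B"
  unfolding kron_def by (rule eq_matI; simp add: div_mod_bounds)+

lemma kron_one: "kron (1\<^sub>m p) (1\<^sub>m q) = 1\<^sub>m (p * q)"
proof (rule eq_matI)
  fix i j assume "i < dim_row (1\<^sub>m (p * q) :: real mat)" "j < dim_col (1\<^sub>m (p * q) :: real mat)"
  then have ij: "i < p * q" "j < p * q" by auto
  have "i = j \<longleftrightarrow> i div q = j div q \<and> i mod q = j mod q"
    by (metis div_mult_mod_eq)
  then show "kron (1\<^sub>m p) (1\<^sub>m q) $$ (i, j) = 1\<^sub>m (p * q) $$ (i, j)"
    using ij by (simp add: kron_def div_mod_bounds)
qed (simp_all add: kron_def)

lemma kron_zero_right: "A \<in> carrier_mat a b \<Longrightarrow> kron A (0\<^sub>m c d) = 0\<^sub>m (a * c) (b * d)"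
  unfolding kron_def by (rule eq_matI) (auto simp: div_mod_bounds)

lemma kron_sum_carrier [simp]:
  "A \<in> carrier_mat p p \<Longrightarrow> B \<in> carrier_mat q q \<Longrightarrow> kron_sum A B \<in> carrier_mat (p * q) (p * q)"
  by (auto simp: kron_sum_def kron_def)

lemma kron_sum_add:
  assumes "A \<in> carrier_mat p p" "A' \<in> carrier_mat p p" "B \<in> carrier_mat q q" "B' \<in> carrier_mat q q"
  shows "kron_sum (A + A') (B + B') = kron_sum A B + kron_sum A' B'"
  using assms by (intro eq_matI) (auto simp: kron_sum_def kron_def div_mod_bounds algebra_simps)

text \<open>
  A feedback that acts on the first factor only changes only the first summand of a Kronecker
  sum.
\<close>

lemma kron_sum_minus_kron_one:
  assumes "A \<in> carrier_mat p p" "Z \<in> carrier_mat p p" "B \<in> carrier_mat q q"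
  shows "kron_sum A B - kron Z (1\<^sub>m q) = kron_sum (A - Z) B"
  using assms by (intro eq_matI) (auto simp: kron_sum_def kron_def div_mod_bounds algebra_simps)

section \<open>Lyapunov expressions of Kronecker sums\<close>

text \<open>
  The matrix of the derivative of the quadratic form of \<open>P\<close> along \<open>x' = X x\<close>; see
  \<open>quad_form_has_derivative\<close>.
\<close>

definition lyap :: "real mat \<Rightarrow> real mat \<Rightarrow> real mat" where
  "lyap X P = X\<^sup>T * P + P * X"

lemma lyap_carrier [simp]:
  "X \<in> carrier_mat k k \<Longrightarrow> P \<in> carrier_mat k k \<Longrightarrow> lyap X P \<in> carrier_mat k k"
  by (auto simp: lyap_def)

lemma lyap_add:
  assumes "X \<in> carrier_mat k k" "Y \<in> carrier_mat k k" "P \<in> carrier_mat k k"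
  shows "lyap (X + Y) P = lyap X P + lyap Y P"
proof -
  have "lyap (X + Y) P = (X\<^sup>T * P + Y\<^sup>T * P) + (P * X + P * Y)"
    using assms by (simp add: lyap_def transpose_add[OF assms(1,2)] add_mult_distrib_mat[of _ k k] mult_add_distrib_mat[of _ k k])
  also have "\<dots> = lyap X P + lyap Y P"
    unfolding lyap_def using assms by (intro eq_matI) auto
  finally show ?thesis .
qed

text \<open>
  A Lyapunov certificate for a Kronecker sum is the Kronecker product of certificates: by the
  mixed-product property, each summand of the dynamics differentiates one factor of the certificate
  and leaves the other unchanged.
\<close>

lemma lyap_kron_sum:
  assumes X: "X \<in> carrier_mat p p" and P: "P \<in> carrier_mat p p"
    and T: "T \<in> carrier_mat q q" and N: "N \<in> carrier_mat q q"
  shows "lyap (kron_sum X T) (kron P N) = kron (lyap X P) N + kron P (lyap T N)"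
proof -
  have Xt: "X\<^sup>T \<in> carrier_mat p p" and Tt: "T\<^sup>T \<in> carrier_mat q q" using X T by auto
  have KX: "kron X (1\<^sub>m q) \<in> carrier_mat (p * q) (p * q)" and KT: "kron (1\<^sub>m p) T \<in> carrier_mat (p * q) (p * q)"
    and PN: "kron P N \<in> carrier_mat (p * q) (p * q)"
    using X T P N by (auto intro!: kron_carrier)
  have S: "kron_sum X T = kron X (1\<^sub>m q) + kron (1\<^sub>m p) T"
    using X T by (simp add: kron_sum_def)
  have 1: "lyap (kron X (1\<^sub>m q)) (kron P N) = kron (lyap X P) N"
    unfolding lyap_def kron_transpose transpose_one
    using kron_add_left[of "X\<^sup>T * P" p p "P * X" N q q] X P N
    by (simp add: kron_mult[OF Xt P one_carrier_mat N] kron_mult[OF P X N one_carrier_mat])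
  have 2: "lyap (kron (1\<^sub>m p) T) (kron P N) = kron P (lyap T N)"
    unfolding lyap_def kron_transpose transpose_one
    using kron_add_right[of P p p "T\<^sup>T * N" q q "N * T"] T P N
    by (simp add: kron_mult[OF one_carrier_mat P Tt N] kron_mult[OF P one_carrier_mat N T])
  show ?thesis unfolding S lyap_add[OF KX KT PN] 1 2 ..
qed

section \<open>Definiteness\<close>

lemma quad_form_add:
  assumes "A \<in> carrier_mat k k" "B \<in> carrier_mat k k" "v \<in> carrier_vec k"
  shows "quad_form (A + B) v = quad_form A v + quad_form B v"
  using assms by (simp add: quad_form_sum[of _ k] sum.distrib algebra_simps)

lemma quad_form_uminus:
  assumes "A \<in> carrier_mat k k" "v \<in> carrier_vec k"
  shows "quad_form (- A) v = - quad_form A v"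
  using assms by (simp add: quad_form_sum[of _ k] sum_negf)

lemma pos_semidef_add:
  assumes "pos_semidef k A" "pos_semidef k B"
  shows "pos_semidef k (A + B)"
  using assms by (auto simp: pos_semidef_def sym_mat_def quad_form_add[of _ k] transpose_add[of _ k k])

lemma neg_semidef_add:
  assumes "neg_semidef k A" "neg_semidef k B" "A \<in> carrier_mat k k" "B \<in> carrier_mat k k"
  shows "neg_semidef k (A + B)"
proof -
  have "- (A + B) = - A + - B" using assms(3,4) by (intro eq_matI) auto
  then show ?thesis using assms pos_semidef_add by (simp add: neg_semidef_def)
qed

lemma neg_semidef_carrier: "neg_semidef k A \<Longrightarrow> A \<in> carrier_mat k k"
  by (simp add: neg_semidef_def pos_semidef_def sym_mat_def)

lemma neg_semidef_quad_form: "neg_semidef k A \<Longrightarrow> v \<in> carrier_vec k \<Longrightarrow> quad_form A v \<le> 0"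
  using quad_form_uminus[of A k v] neg_semidef_carrier[of k A]
  by (auto simp: neg_semidef_def pos_semidef_def)

lemma neg_semidef_kron_left: "neg_semidef p A \<Longrightarrow> pos_semidef q B \<Longrightarrow> neg_semidef (p * q) (kron A B)"
  using pos_semidef_kron[of p "- A" q B] by (simp add: neg_semidef_def kron_uminus)

lemma neg_semidef_kron_right: "pos_semidef p A \<Longrightarrow> neg_semidef q B \<Longrightarrow> neg_semidef (p * q) (kron A B)"
  using pos_semidef_kron[of p A q "- B"] by (simp add: neg_semidef_def kron_uminus)

lemma pos_def_imp_pos_semidef: "pos_def k A \<Longrightarrow> pos_semidef k A"
  unfolding pos_def_def pos_semidef_def
  by (metis (no_types) order.order_iff_strict quad_form_def scalar_prod_left_zero sym_mat_def mult_mat_vec_carrier)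

lemma neg_def_imp_neg_semidef: "neg_def k A \<Longrightarrow> neg_semidef k A"
  by (simp add: neg_def_def neg_semidef_def pos_def_imp_pos_semidef)

section \<open>Iterated Kronecker products and sums\<close>

lemma kron_list_Cons [simp]: "kron_list (A # As) = kron A (kron_list As)"
  by (simp add: kron_list_def)

lemma kron_list_Nil [simp]: "kron_list [] = 1\<^sub>m 1"
  by (simp add: kron_list_def)

lemma kron_sum_list_Cons [simp]: "kron_sum_list (A # As) = kron_sum A (kron_sum_list As)"
  by (simp add: kron_sum_list_def)

lemma kron_sum_list_Nil [simp]: "kron_sum_list [] = 0\<^sub>m 1 1"
  by (simp add: kron_sum_list_def)

lemma kron_list_carrier:
  "(\<And>i. i \<in> set ks \<Longrightarrow> M i \<in> carrier_mat (n i) (n i)) \<Longrightarrow>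
   kron_list (map M ks) \<in> carrier_mat (prod_list (map n ks)) (prod_list (map n ks))"
  by (induction ks) auto

lemma kron_sum_list_carrier:
  "(\<And>i. i \<in> set ks \<Longrightarrow> A i \<in> carrier_mat (n i) (n i)) \<Longrightarrow>
   kron_sum_list (map A ks) \<in> carrier_mat (prod_list (map n ks)) (prod_list (map n ks))"
  by (induction ks) auto

lemma kron_list_one: "kron_list (map (\<lambda>i. 1\<^sub>m (n i)) ks) = 1\<^sub>m (prod_list (map n ks))"
  by (induction ks) (auto simp: kron_one)

lemma pos_semidef_one: "pos_semidef k (1\<^sub>m k)"
  by (auto simp: pos_semidef_def sym_mat_def quad_form_def scalar_prod_def intro!: sum_nonneg)

lemma pos_semidef_kron_list:
  "(\<And>i. i \<in> set ks \<Longrightarrow> pos_semidef (n i) (M i)) \<Longrightarrow>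
   pos_semidef (prod_list (map n ks)) (kron_list (map M ks))"
  by (induction ks) (auto simp: pos_semidef_one pos_semidef_kron)

lemma lyap_zero: "lyap (0\<^sub>m 1 1) (1\<^sub>m 1) = 0\<^sub>m 1 1"
  unfolding lyap_def by (rule eq_matI) (auto simp: scalar_prod_def)

text \<open>
  Stability certificates of the factors combine to one for their Kronecker sum, by applying the
  two-factor identity repeatedly.
\<close>

lemma neg_semidef_lyap_kron_list:
  assumes "\<And>i. i \<in> set ks \<Longrightarrow> X i \<in> carrier_mat (n i) (n i)"
    and "\<And>i. i \<in> set ks \<Longrightarrow> pos_semidef (n i) (M i)"
    and "\<And>i. i \<in> set ks \<Longrightarrow> neg_semidef (n i) (lyap (X i) (M i))"
  shows "neg_semidef (prod_list (map n ks)) (lyap (kron_sum_list (map X ks)) (kron_list (map M ks)))"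
  using assms
proof (induction ks)
  case Nil
  have "- 0\<^sub>m 1 1 = (0\<^sub>m 1 1 :: real mat)" by (rule eq_matI) auto
  then show ?case
    by (auto simp: lyap_zero neg_semidef_def pos_semidef_def sym_mat_def quad_form_sum[of _ 1] simp del: One_nat_def)
next
  case (Cons k ks)
  let ?q = "prod_list (map n ks)"
  have T: "kron_sum_list (map X ks) \<in> carrier_mat ?q ?q" using Cons.prems(1) by (intro kron_sum_list_carrier) auto
  have N: "pos_semidef ?q (kron_list (map M ks))" using Cons.prems(2) by (intro pos_semidef_kron_list) auto
  have X: "X k \<in> carrier_mat (n k) (n k)" and M: "pos_semidef (n k) (M k)"
    and XM: "neg_semidef (n k) (lyap (X k) (M k))"
    using Cons.prems by auto
  have IH: "neg_semidef ?q (lyap (kron_sum_list (map X ks)) (kron_list (map M ks)))"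
    using Cons by auto
  note 1 = neg_semidef_kron_left[OF XM N] and 2 = neg_semidef_kron_right[OF M IH]
  show ?case
    by (simp add: lyap_kron_sum[OF X pos_semidef_carrier[OF M] T pos_semidef_carrier[OF N]]
        neg_semidef_add[OF 1 2 neg_semidef_carrier[OF 1] neg_semidef_carrier[OF 2]])
qed

lemma mat_sum_list_Nil [simp]: "mat_sum_list r c [] = 0\<^sub>m r c"
  by (simp add: mat_sum_list_def)

lemma mat_sum_list_Cons [simp]: "mat_sum_list r c (A # As) = A + mat_sum_list r c As"
  by (simp add: mat_sum_list_def)

lemma mat_sum_list_carrier:
  "(\<And>X. X \<in> set Xs \<Longrightarrow> X \<in> carrier_mat r c) \<Longrightarrow> mat_sum_list r c Xs \<in> carrier_mat r c"
  by (induction Xs) auto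

lemma mat_sum_list_kron:
  assumes K: "K \<in> carrier_mat p p"
  shows "(\<And>X. X \<in> set Xs \<Longrightarrow> X \<in> carrier_mat q q) \<Longrightarrow>
    mat_sum_list (p * q) (p * q) (map (kron K) Xs) = kron K (mat_sum_list q q Xs)"
proof (induction Xs)
  case Nil
  show ?case using kron_zero_right[OF K] by simp
next
  case (Cons X Xs)
  then show ?case
    using kron_add_right[OF K, of X q q "mat_sum_list q q Xs"] mat_sum_list_carrier[of Xs q q] by auto
qed

text \<open>
  This is a product rule: each summand of the Kronecker sum differentiates one factor of the
  product. The indices have to be distinct, since updating \<open>M\<close> at \<open>i\<close> changes every occurrence of \<open>i\<close> in the list.
\<close>

lemma lyap_kron_list:
  assumes "distinct ks"
    and "\<And>i. i \<in> set ks \<Longrightarrow> A i \<in> carrier_mat (n i) (n i)"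
    and "\<And>i. i \<in> set ks \<Longrightarrow> M i \<in> carrier_mat (n i) (n i)"
    and "\<And>i. i \<in> set ks \<Longrightarrow> F i = lyap (A i) (M i)"
  shows "mat_sum_list (prod_list (map n ks)) (prod_list (map n ks))
      (map (\<lambda>i. kron_list (map (M(i := F i)) ks)) ks) =
    lyap (kron_sum_list (map A ks)) (kron_list (map M ks))"
  using assms
proof (induction ks)
  case Nil
  show ?case using lyap_zero by simp
next
  case (Cons k ks)
  let ?q = "prod_list (map n ks)"
  let ?X = "\<lambda>i. kron_list (map (M(i := F i)) ks)"
  have A: "A k \<in> carrier_mat (n k) (n k)" and M: "M k \<in> carrier_mat (n k) (n k)"
    and F: "F k = lyap (A k) (M k)" and k: "k \<notin> set ks"
    using Cons.prems by auto
  have T: "kron_sum_list (map A ks) \<in> carrier_mat ?q ?q" and N: "kron_list (map M ks) \<in> carrier_mat ?q ?q"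
    using Cons.prems by (auto intro!: kron_sum_list_carrier kron_list_carrier)
  have X: "?X i \<in> carrier_mat ?q ?q" if "i \<in> set ks" for i
    using Cons.prems(2-4) that by (intro kron_list_carrier) auto
  have IH: "mat_sum_list ?q ?q (map ?X ks) = lyap (kron_sum_list (map A ks)) (kron_list (map M ks))"
    by (rule Cons.IH) (use Cons.prems in auto)
  define g where "g = (\<lambda>i. kron_list (map (M(i := F i)) (k # ks)))"
  have head: "g k = kron (F k) (kron_list (map M ks))"
    using k by (simp add: g_def map_fun_upd)
  have tail: "map g ks = map (kron (M k)) (map ?X ks)"
    using k by (auto simp: g_def)
  have "mat_sum_list (n k * ?q) (n k * ?q) (map (kron (M k)) (map ?X ks)) = kron (M k) (mat_sum_list ?q ?q (map ?X ks))"
    by (rule mat_sum_list_kron[OF M]) (use X in auto)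
  then have "mat_sum_list (n k * ?q) (n k * ?q) (map g (k # ks)) =
      kron (F k) (kron_list (map M ks)) + kron (M k) (mat_sum_list ?q ?q (map ?X ks))"
    by (simp add: head tail del: map_map)
  then have "mat_sum_list (n k * ?q) (n k * ?q) (map g (k # ks)) =
      lyap (kron_sum_list (map A (k # ks))) (kron_list (map M (k # ks)))"
    by (simp add: IH F lyap_kron_sum[OF A M T N])
  then show ?case
    by (simp only: g_def list.map prod_list.Cons)
qed

section \<open>The Riccati equation\<close>

text \<open>
  A positive definite matrix has trivial kernel, hence nonzero determinant, so that Gauss--Jordan
  elimination succeeds and \<open>mat_inv\<close> does not take its default value.
\<close>

lemma mat_inv_pos_def:
  assumes R: "pos_def r R"
  shows "mat_inv R \<in> carrier_mat r r" "R * mat_inv R = 1\<^sub>m r" "mat_inv R * R = 1\<^sub>m r" "(mat_inv R)\<^sup>T = mat_inv R"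
proof -
  have c: "R \<in> carrier_mat r r" and sym: "R\<^sup>T = R" using R by (auto simp: pos_def_def sym_mat_def)
  have "det R \<noteq> 0"
  proof
    assume "det R = 0"
    then obtain v where v: "v \<in> carrier_vec r" "v \<noteq> 0\<^sub>v r" "R *\<^sub>v v = 0\<^sub>v r"
      using det_0_iff_vec_prod_zero_field[OF c] by auto
    then have "quad_form R v = 0" by (simp add: quad_form_def)
    with R v show False by (auto simp: pos_def_def)
  qed
  then have "R \<in> Units (ring_mat TYPE(real) r ())" by (rule det_non_zero_imp_unit[OF c])
  then obtain S where S: "mat_inverse R = Some S"
    using mat_inverse(1)[OF c, of "()"] by (cases "mat_inverse R") auto
  from mat_inverse(2)[OF c S] show 1: "mat_inv R \<in> carrier_mat r r" "R * mat_inv R = 1\<^sub>m r" "mat_inv R * R = 1\<^sub>m r"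
    by (auto simp: mat_inv_def S)
  let ?S = "mat_inv R"
  \<comment> \<open>Since \<open>R\<close> is symmetric, \<open>?S\<^sup>T\<close> is also a left inverse of \<open>R\<close>, so it agrees with the right inverse \<open>?S\<close>.\<close>
  have "?S\<^sup>T * R = 1\<^sub>m r"
    using arg_cong[OF 1(2), of transpose_mat] transpose_mult[OF c 1(1)] sym by simp
  then have "?S\<^sup>T * R * ?S = ?S" using 1 by simp
  moreover have "?S\<^sup>T * R * ?S = ?S\<^sup>T * (R * ?S)" using 1(1) c by (intro assoc_mult_mat) auto
  ultimately show "?S\<^sup>T = ?S" using 1 by simp
qed

text \<open>
  With the gain \<open>K\<close>, the three terms \<open>P (B K)\<close>, \<open>(B K)\<^sup>T P\<close> and \<open>K\<^sup>T R K\<close> are all equal to the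
  quadratic term \<open>W\<close> of the Riccati equation. The closed-loop expression therefore contains
  \<open>- 2 W + W = - W\<close>, and the Riccati equation removes everything except the uncertainty and its
  bound \<open>U\<close>.
\<close>

lemma riccati_closed_loop:
  assumes A: "A \<in> carrier_mat p p" and E: "E \<in> carrier_mat p p" and B: "B \<in> carrier_mat p r"
    and P: "sym_mat p P" and R: "pos_def r R" and Q: "Q \<in> carrier_mat p p" and U: "U \<in> carrier_mat p p"
    and ric: "A\<^sup>T * P + P * A + Q - P * B * mat_inv R * B\<^sup>T * P + U = 0\<^sub>m p p"
    and K: "K = mat_inv R * B\<^sup>T * P"
  shows "lyap (A + E - B * K) P + Q + K\<^sup>T * R * K = lyap E P - U"
proof -
  note S = mat_inv_pos_def[OF R]
  have cP: "P \<in> carrier_mat p p" "P\<^sup>T = P" and cR: "R \<in> carrier_mat r r"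
    using P R by (auto simp: sym_mat_def pos_def_def)
  let ?S = "mat_inv R"
  let ?W = "P * (B * (?S * (B\<^sup>T * P)))"
  note dims = A E B cP cR S(1)
  have SR: "?S * (R * X) = X" if "dim_row X = r" for X
    using that S(1,3) cR left_mult_one_mat[of X r "dim_col X"]
    by (subst mult_assoc_dim[symmetric]) auto
  have W: "P * B * ?S * B\<^sup>T * P = ?W" using dims by (simp add: mult_assoc_dim)
  have Kt: "K\<^sup>T = P * (B * ?S)" using dims S(4) by (simp add: K transpose_mult_dim mult_assoc_dim)
  have cK: "K \<in> carrier_mat r p" using dims by (auto simp: K)
  have PBK: "P * (B * K) = ?W" using dims by (simp add: K mult_assoc_dim)
  have BKP: "(B * K)\<^sup>T * P = ?W" using dims cK by (simp add: transpose_mult_dim Kt mult_assoc_dim)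
  have KRK: "K\<^sup>T * R * K = ?W"
    unfolding Kt unfolding K using dims by (simp add: mult_assoc_dim SR)
  have cW: "?W \<in> carrier_mat p p" using dims by auto
  have "lyap (A + E - B * K) P = (A\<^sup>T * P + E\<^sup>T * P - ?W) + (P * A + P * E - ?W)"
  proof -
    have BK: "B * K \<in> carrier_mat p p" and AE: "A + E \<in> carrier_mat p p" using dims cK by auto
    have "(A + E - B * K)\<^sup>T * P = A\<^sup>T * P + E\<^sup>T * P - ?W"
      unfolding transpose_minus[OF AE BK] transpose_add[OF A E] BKP[symmetric]
      using dims BK by (subst minus_mult_distrib_mat[of _ p p _ _ p], simp, simp, simp) (simp add: add_mult_distrib_mat[of _ p p])
    moreover have "P * (A + E - B * K) = P * A + P * E - ?W"
      unfolding mult_minus_distrib_mat[OF cP(1) AE BK] mult_add_distrib_mat[OF cP(1) A E] PBK ..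
    ultimately show ?thesis by (simp only: lyap_def)
  qed
  moreover have "(A\<^sup>T * P + E\<^sup>T * P - ?W) + (P * A + P * E - ?W) + Q + ?W = lyap E P - U"
  proof (rule eq_matI)
    fix i j assume "i < dim_row (lyap E P - U)" "j < dim_col (lyap E P - U)"
    then have ij: "i < p" "j < p" using U by auto
    have "(A\<^sup>T * P + P * A + Q - ?W + U) $$ (i, j) = 0" using ric ij unfolding W by simp
    then have "(A\<^sup>T * P) $$ (i, j) + (P * A) $$ (i, j) + Q $$ (i, j) - ?W $$ (i, j) + U $$ (i, j) = 0"
      using ij dims Q U cW by (simp del: index_mult_mat(1))
    then show "((A\<^sup>T * P + E\<^sup>T * P - ?W) + (P * A + P * E - ?W) + Q + ?W) $$ (i, j) = (lyap E P - U) $$ (i, j)"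
      using ij dims Q U cW by (simp add: lyap_def del: index_mult_mat(1))
  qed (use dims Q U in \<open>auto simp: lyap_def\<close>)
  ultimately show ?thesis unfolding KRK by simp
qed

section \<open>Integrating a dissipation inequality\<close>

text \<open>
  A nonnegative storage function \<open>V\<close> that decreases at least at the rate \<open>f\<close> bounds the integral
  of \<open>f\<close> over each interval \<open>{0..T}\<close> by \<open>V 0 - V T \<le> V 0\<close>. These integrals increase with \<open>T\<close>,
  so they converge, and monotone convergence gives integrability over the half-line.
\<close>

lemma dissipation_inequality_integral:
  fixes f V V' :: "real \<Rightarrow> real"
  assumes cont: "continuous_on {0..} f" and f: "\<And>t. 0 \<le> t \<Longrightarrow> 0 \<le> f t" and V: "\<And>t. 0 \<le> t \<Longrightarrow> 0 \<le> V t"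
    and deriv: "\<And>t. 0 \<le> t \<Longrightarrow> (V has_real_derivative V' t) (at t within {0..})"
    and diss: "\<And>t. 0 \<le> t \<Longrightarrow> V' t + f t \<le> 0"
  shows "set_integrable lborel {0..} f \<and> (LINT t:{0..}|lborel. f t) \<le> V 0"
proof -
  let ?A = "\<lambda>i::nat. {0..real i}"
  let ?G = "\<lambda>i::nat. LINT t:?A i|lborel. f t"
  have int: "set_integrable lborel (?A i) f" for i
    by (rule borel_integrable_atLeastAtMost') (rule continuous_on_subset[OF cont], auto)
  have hk: "(f has_integral ?G i) (?A i)" for i
    using set_borel_integral_eq_integral[OF int[of i]] by (simp add: has_integral_integral)
  have bound: "?G i \<le> V 0" for i
  proof -
    have "(V' has_integral V (real i) - V 0) (?A i)"
      by (rule fundamental_theorem_of_calculus)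
        (auto simp flip: has_real_derivative_iff_has_vector_derivative
          intro: has_field_derivative_subset[OF deriv])
    from has_integral_neg[OF this] have "?G i \<le> - (V (real i) - V 0)"
    proof (rule has_integral_le[OF hk])
      show "f t \<le> - V' t" if "t \<in> ?A i" for t using diss[of t] that by auto
    qed
    then show ?thesis using V[of "real i"] by simp
  qed
  have "incseq ?G"
  proof (rule incseq_SucI)
    fix i
    show "?G i \<le> ?G (Suc i)"
      by (rule has_integral_subset_le[OF _ hk hk]) (use f in auto)
  qed
  then obtain L where L: "?G \<longlonglongrightarrow> L"
    using incseq_convergent[of ?G "V 0"] bound by blast
  have un: "(\<Union>i. ?A i) = {0..}"
    using real_arch_simple by auto
  have "set_integrable lborel (\<Union>i. ?A i) f"
    by (rule pos_integrable_to_top[OF _ _ _ int L]) (use f in \<open>auto simp: mono_def\<close>)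
  moreover have "?G \<longlonglongrightarrow> (LINT t:(\<Union>i. ?A i)|lborel. f t)"
    by (rule set_integral_cont_up) (use calculation in \<open>auto simp: incseq_def\<close>)
  ultimately show ?thesis
    unfolding un using LIMSEQ_le_const2 bound by blast
qed

section \<open>Cost of a linear state feedback\<close>

lemma quad_form_lyap:
  assumes X: "X \<in> carrier_mat k k" and P: "P \<in> carrier_mat k k" and v: "v \<in> carrier_vec k"
  shows "quad_form (lyap X P) v = (X *\<^sub>v v) \<bullet> (P *\<^sub>v v) + v \<bullet> (P *\<^sub>v (X *\<^sub>v v))"
proof -
  have Xv: "X *\<^sub>v v \<in> carrier_vec k" and Pv: "P *\<^sub>v v \<in> carrier_vec k" using X P v by auto
  have "quad_form (X\<^sup>T * P) v = v \<bullet> (X\<^sup>T *\<^sub>v (P *\<^sub>v v))"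
    unfolding quad_form_def using X P v by (subst assoc_mult_mat_vec[of _ k k _ k]) auto
  also have "\<dots> = (X\<^sup>T *\<^sub>v (P *\<^sub>v v)) \<bullet> v"
    using X P v by (intro comm_scalar_prod[of _ k]) auto
  also have "\<dots> = (X *\<^sub>v v) \<bullet> (P *\<^sub>v v)"
    unfolding transpose_vec_mult_scalar[OF X v Pv] using comm_scalar_prod[OF Pv Xv] .
  finally have "quad_form (X\<^sup>T * P) v = (X *\<^sub>v v) \<bullet> (P *\<^sub>v v)" .
  moreover have "quad_form (P * X) v = v \<bullet> (P *\<^sub>v (X *\<^sub>v v))"
    unfolding quad_form_def using X P v by (subst assoc_mult_mat_vec[of _ k k _ k]) auto
  ultimately show ?thesis
    unfolding lyap_def using X P v by (subst quad_form_add[of _ k]) auto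
qed

lemma quad_form_has_derivative:
  assumes X: "X \<in> carrier_mat k k" and P: "P \<in> carrier_mat k k"
    and x: "\<And>s. s \<in> S \<Longrightarrow> x s \<in> carrier_vec k" and t: "t \<in> S"
    and deriv: "\<And>i. i < k \<Longrightarrow> ((\<lambda>s. x s $ i) has_real_derivative (X *\<^sub>v x t) $ i) (at t within S)"
  shows "((\<lambda>s. quad_form P (x s)) has_real_derivative quad_form (lyap X P) (x t)) (at t within S)"
proof -
  let ?d = "X *\<^sub>v x t"
  have d: "?d \<in> carrier_vec k" using X x[OF t] by auto
  have val: "quad_form (lyap X P) (x t) =
      (\<Sum>i<k. \<Sum>j<k. P $$ (i, j) * ?d $ i * x t $ j + P $$ (i, j) * x t $ i * ?d $ j)"
    unfolding quad_form_lyap[OF X P x[OF t]] bilinear_form_sum[OF P d x[OF t]]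
      bilinear_form_sum[OF P x[OF t] d] by (simp add: sum.distrib)
  have "((\<lambda>s. \<Sum>i<k. \<Sum>j<k. P $$ (i, j) * x s $ i * x s $ j) has_real_derivative
      quad_form (lyap X P) (x t)) (at t within S)"
    unfolding val
    by (intro DERIV_sum) (auto intro!: derivative_eq_intros deriv simp: algebra_simps simp del: index_mult_mat_vec)
  then show ?thesis
    by (rule has_field_derivative_transform_within[of _ _ _ _ 1])
      (use t x in \<open>auto simp: quad_form_sum[OF P]\<close>)
qed

lemma closed_loop_rhs:
  fixes A B K :: "real mat"
  assumes A: "A \<in> carrier_mat k k" and B: "B \<in> carrier_mat k r" and K: "K \<in> carrier_mat r k"
    and v: "v \<in> carrier_vec k"
  shows "A *\<^sub>v v + B *\<^sub>v (- (K *\<^sub>v v)) = (A - B * K) *\<^sub>v v"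
proof -
  have BK: "B * K \<in> carrier_mat k k" and Kv: "K *\<^sub>v v \<in> carrier_vec r" using B K v by auto
  have "(A - B * K) *\<^sub>v v = A *\<^sub>v v - B *\<^sub>v (K *\<^sub>v v)"
    unfolding minus_mult_distrib_mat_vec[OF A BK v] using B K v by simp
  also have "\<dots> = A *\<^sub>v v + B *\<^sub>v (- (K *\<^sub>v v))"
    using A B K v by (intro eq_vecI) auto
  finally show ?thesis ..
qed

lemma quad_form_feedback:
  assumes R: "R \<in> carrier_mat r r" and K: "K \<in> carrier_mat r k" and v: "v \<in> carrier_vec k"
  shows "quad_form R (- (K *\<^sub>v v)) = quad_form (K\<^sup>T * R * K) v"
proof -
  have Kv: "K *\<^sub>v v \<in> carrier_vec r" using K v by auto
  have RKv: "R *\<^sub>v (K *\<^sub>v v) \<in> carrier_vec r" using R Kv by auto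
  have "quad_form R (- (K *\<^sub>v v)) = quad_form R (K *\<^sub>v v)"
    using uminus_carrier_vec[of "K *\<^sub>v v" r] carrier_vecD[OF Kv] Kv
    by (simp add: quad_form_sum[OF R] del: dim_mult_mat_vec)
  also have "\<dots> = (R *\<^sub>v (K *\<^sub>v v)) \<bullet> (K *\<^sub>v v)"
    unfolding quad_form_def by (rule comm_scalar_prod[OF Kv RKv])
  also have "\<dots> = (K\<^sup>T *\<^sub>v (R *\<^sub>v (K *\<^sub>v v))) \<bullet> v"
    by (rule transpose_vec_mult_scalar[OF K v RKv, symmetric])
  also have "\<dots> = v \<bullet> (K\<^sup>T *\<^sub>v (R *\<^sub>v (K *\<^sub>v v)))"
    using K RKv v by (intro comm_scalar_prod[of _ k]) auto
  also have "K\<^sup>T *\<^sub>v (R *\<^sub>v (K *\<^sub>v v)) = K\<^sup>T * R * K *\<^sub>v v"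
  proof -
    have Kt: "K\<^sup>T \<in> carrier_mat k r" and KR: "K\<^sup>T * R \<in> carrier_mat k r" using K R by auto
    show ?thesis
      unfolding assoc_mult_mat_vec[OF KR K v] assoc_mult_mat_vec[OF Kt R Kv] ..
  qed
  finally show ?thesis by (simp add: quad_form_def)
qed

text \<open>
  Under the feedback, storage rate and running cost are quadratic forms of the state, so a matrix
  inequality suffices for the dissipation inequality. Semidefiniteness of \<open>Q\<close> and \<open>R\<close> makes the
  running cost nonnegative.
\<close>

lemma state_feedback_cost_bound:
  assumes A: "A \<in> carrier_mat k k" and B: "B \<in> carrier_mat k r" and K: "K \<in> carrier_mat r k"
    and P: "pos_semidef k P" and Q: "pos_semidef k Q" and R: "pos_semidef r R"
    and sol: "lti_solution A B u x0 x" and u: "\<And>t. t \<ge> 0 \<Longrightarrow> u t = - (K *\<^sub>v x t)"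
    and diss: "\<And>v. v \<in> carrier_vec k \<Longrightarrow> quad_form (lyap (A - B * K) P + Q + K\<^sup>T * R * K) v \<le> 0"
  shows "set_integrable lborel {0..} (\<lambda>t. quad_form Q (x t) + quad_form R (u t)) \<and>
    (LINT t:{0..}|lborel. quad_form Q (x t) + quad_form R (u t)) \<le> quad_form P x0"
proof -
  note c = A B K pos_semidef_carrier[OF P] pos_semidef_carrier[OF Q] pos_semidef_carrier[OF R]
  have X: "A - B * K \<in> carrier_mat k k" and KRK: "K\<^sup>T * R * K \<in> carrier_mat k k" using c by auto
  have x: "x t \<in> carrier_vec k" if "t \<in> {0..}" for t
    using sol that A by (auto simp: lti_solution_def)
  have deriv: "((\<lambda>s. x s $ i) has_real_derivative ((A - B * K) *\<^sub>v x t) $ i) (at t within {0..})"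
    if "t \<in> {0..}" "i < k" for t i
  proof -
    have "((\<lambda>s. x s $ i) has_real_derivative (A *\<^sub>v x t + B *\<^sub>v u t) $ i) (at t within {0..})"
      using sol that A unfolding lti_solution_def by auto
    then show ?thesis
      using u[of t] closed_loop_rhs[OF A B K x[OF that(1)]] that(1) by simp
  qed
  let ?W = "Q + K\<^sup>T * R * K"
  have cost: "quad_form Q (x t) + quad_form R (u t) = quad_form ?W (x t)" if "t \<in> {0..}" for t
    using quad_form_feedback[OF c(6) K x[OF that]] quad_form_add[OF c(5) KRK x[OF that]] u[of t] that by simp
  have Vd: "((\<lambda>s. quad_form Z (x s)) has_real_derivative quad_form (lyap (A - B * K) Z) (x t)) (at t within {0..})"
    if "t \<in> {0..}" "Z \<in> carrier_mat k k" for t Z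
    by (rule quad_form_has_derivative[OF X that(2) x that(1) deriv[OF that(1)]])
  have W: "?W \<in> carrier_mat k k" using c KRK by auto
  have "set_integrable lborel {0..} (\<lambda>t. quad_form Q (x t) + quad_form R (u t)) \<and>
    (LINT t:{0..}|lborel. quad_form Q (x t) + quad_form R (u t)) \<le> quad_form P (x 0)"
  proof (rule dissipation_inequality_integral)
    have "continuous_on {0..} (\<lambda>t. quad_form ?W (x t))"
      by (rule DERIV_continuous_on) (rule Vd[OF _ W])
    then show "continuous_on {0..} (\<lambda>t. quad_form Q (x t) + quad_form R (u t))"
      using cost by (simp cong: continuous_on_cong_simp)
    fix t :: real assume t: "0 \<le> t"
    then have t': "t \<in> {0..}" by simp
    have "u t \<in> carrier_vec r" using sol t B by (auto simp: lti_solution_def)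
    then show "0 \<le> quad_form Q (x t) + quad_form R (u t)"
      using Q R x[OF t'] by (auto simp: pos_semidef_def)
    show "0 \<le> quad_form P (x t)" using P x[OF t'] by (auto simp: pos_semidef_def)
    show "((\<lambda>s. quad_form P (x s)) has_real_derivative quad_form (lyap (A - B * K) P) (x t)) (at t within {0..})"
      by (rule Vd[OF t' c(4)])
    have "lyap (A - B * K) P + Q + K\<^sup>T * R * K = lyap (A - B * K) P + ?W"
      using c KRK X by (intro assoc_add_mat) auto
    then show "quad_form (lyap (A - B * K) P) (x t) + (quad_form Q (x t) + quad_form R (u t)) \<le> 0"
      using diss[OF x[OF t']] quad_form_add[OF lyap_carrier[OF X c(4)] W x[OF t']] cost[OF t'] by simp
  qed
  then show ?thesis using sol by (simp add: lti_solution_def)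
qed

section \<open>Guaranteed cost for Kronecker sum dynamics\<close>

theorem theorem2:
  fixes m p1 :: nat and n :: "nat \<Rightarrow> nat"
    and A M F :: "nat \<Rightarrow> real mat" and D :: "nat \<Rightarrow> real mat set"
    and B1 Q1 R1 P1 K1 :: "real mat" and U1 :: "real mat \<Rightarrow> real mat"
    and A_sum B_kron P_kron R_kron Q_kron K_kron :: "real mat"
    and \<Delta>A :: "nat \<Rightarrow> real mat" and \<Delta>A_sum :: "real mat"
    and x0 :: "real Matrix.vec" and x u :: "real \<Rightarrow> real Matrix.vec"
  assumes "m \<ge> 2"
    and "\<And>i. i \<in> {1..m} \<Longrightarrow> A i \<in> carrier_mat (n i) (n i)"
    and "\<And>i. i \<in> {1..m} \<Longrightarrow> D i \<subseteq> carrier_mat (n i) (n i)"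
    and "B1 \<in> carrier_mat (n 1) p1"
    and "A_sum = kron_sum_list (map A [1..<Suc m])"
    and "B_kron = kron_list (B1 # map (\<lambda>i. 1\<^sub>m (n i)) [2..<Suc m])"
    and "pos_semidef (n 1) Q1"
    and "pos_def p1 R1"
    and "\<And>P. pos_def (n 1) P \<Longrightarrow> pos_semidef (n 1) (U1 P)"
    and "\<And>P E. pos_def (n 1) P \<Longrightarrow> E \<in> D 1 \<Longrightarrow> loewner_le (n 1) (E\<^sup>T * P + P * E) (U1 P)"
    and "pos_def (n 1) P1"
    and "(A 1)\<^sup>T * P1 + P1 * A 1 + Q1 - P1 * B1 * mat_inv R1 * B1\<^sup>T * P1 + U1 P1 = 0\<^sub>m (n 1) (n 1)"
    and "K1 = mat_inv R1 * B1\<^sup>T * P1"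
    and "\<And>i. i \<in> {2..m} \<Longrightarrow> pos_def (n i) (M i)"
    and "\<And>i. i \<in> {2..m} \<Longrightarrow> F i = (A i)\<^sup>T * M i + M i * A i"
    and "\<And>i. i \<in> {2..m} \<Longrightarrow> neg_semidef (n i) (F i)"
    and "\<And>i E. i \<in> {2..m} \<Longrightarrow> E \<in> D i \<Longrightarrow> neg_def (n i) (E\<^sup>T * M i + M i * E)"
    and "P_kron = kron_list (P1 # map M [2..<Suc m])"
    and "R_kron = kron_list (R1 # map M [2..<Suc m])"
    and "Q_kron = kron_list (Q1 # map M [2..<Suc m]) -
           kron P1 (mat_sum_list (\<Prod>i\<in>{2..m}. n i) (\<Prod>i\<in>{2..m}. n i)
             (map (\<lambda>i. kron_list (map (M(i := F i)) [2..<Suc m])) [2..<Suc m]))"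
    and "K_kron = kron_list (K1 # map (\<lambda>i. 1\<^sub>m (n i)) [2..<Suc m])"
    and "\<And>i. i \<in> {1..m} \<Longrightarrow> \<Delta>A i \<in> D i"
    and "\<Delta>A_sum = kron_sum_list (map \<Delta>A [1..<Suc m])"
    and "x0 \<in> carrier_vec (\<Prod>i\<in>{1..m}. n i)"
    and "lti_solution (A_sum + \<Delta>A_sum) B_kron u x0 x"
    and "\<And>t. t \<ge> 0 \<Longrightarrow> u t = - (K_kron *\<^sub>v x t)"
  shows "set_integrable lborel {0..} (\<lambda>t. quad_form Q_kron (x t) + quad_form R_kron (u t)) \<and>
         (LINT t:{0..}|lborel. quad_form Q_kron (x t) + quad_form R_kron (u t)) \<le> quad_form P_kron x0"
proof -
  define ks where "ks = [2..<Suc m]"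
  define q where "q = prod_list (map n ks)"
  define T where "T = kron_sum_list (map A ks)"
  define T' where "T' = kron_sum_list (map \<Delta>A ks)"
  define N where "N = kron_list (map M ks)"
  have idx: "[1..<Suc m] = 1 # ks" using upt_conv_Cons[of 1 "Suc m"] assms(1) by (simp add: ks_def numeral_2_eq_2)
  have set_ks: "set ks = {2..m}" and distinct_ks: "distinct ks" by (auto simp: ks_def)
  have q_prod: "(\<Prod>i\<in>{2..m}. n i) = q"
    using prod.distinct_set_conv_list[OF distinct_ks, of n] by (simp add: q_def set_ks)
  have m1: "1 \<in> {1..m}" and sub: "\<And>i. i \<in> set ks \<Longrightarrow> i \<in> {1..m}" "\<And>i. i \<in> set ks \<Longrightarrow> i \<in> {2..m}"
    using assms(1) by (auto simp: set_ks)
  have cA: "A i \<in> carrier_mat (n i) (n i)" and cE: "\<Delta>A i \<in> carrier_mat (n i) (n i)" if "i \<in> {1..m}" for i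
    using assms(2,3,22) that by blast+
  note A1 = cA[OF m1] and E1 = cE[OF m1] and B1 = assms(4)
  have P1: "pos_semidef (n 1) P1" and cP1: "P1 \<in> carrier_mat (n 1) (n 1)" and sP1: "sym_mat (n 1) P1"
    using assms(11) pos_def_imp_pos_semidef by (auto simp: pos_def_def sym_mat_def)
  have R1: "pos_semidef p1 R1" and cR1: "R1 \<in> carrier_mat p1 p1"
    using assms(8) pos_def_imp_pos_semidef by (auto simp: pos_def_def sym_mat_def)
  have cQ1: "Q1 \<in> carrier_mat (n 1) (n 1)" using assms(7) by (rule pos_semidef_carrier)
  have cU: "U1 P1 \<in> carrier_mat (n 1) (n 1)" using assms(9)[OF assms(11)] by (rule pos_semidef_carrier)
  have cK1: "K1 \<in> carrier_mat p1 (n 1)"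
    using mat_inv_pos_def(1)[OF assms(8)] B1 cP1 by (auto simp: assms(13))
  have M: "pos_semidef (n i) (M i)" if "i \<in> set ks" for i
    using assms(14)[OF sub(2)[OF that]] by (rule pos_def_imp_pos_semidef)
  have N: "pos_semidef q N" and cN: "N \<in> carrier_mat q q"
    using pos_semidef_kron_list[of ks n M] M pos_semidef_carrier by (auto simp: N_def q_def)
  have cT: "T \<in> carrier_mat q q" and cT': "T' \<in> carrier_mat q q"
    unfolding T_def T'_def q_def using sub(1) cA cE by (auto intro!: kron_sum_list_carrier)
  have F: "F i = lyap (A i) (M i)" if "i \<in> set ks" for i
    using assms(15)[OF sub(2)[OF that]] by (simp add: lyap_def)
  have S: "neg_semidef q (lyap T N)" unfolding q_def T_def N_def
    using sub cA M assms(16) F by (intro neg_semidef_lyap_kron_list) force+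
  have S': "neg_semidef q (lyap T' N)" unfolding q_def T'_def N_def
    using sub cE M by (intro neg_semidef_lyap_kron_list)
      (auto simp: lyap_def intro!: neg_def_imp_neg_semidef assms(17,22))
  have "mat_sum_list q q (map (\<lambda>i. kron_list (map (M(i := F i)) ks)) ks) = lyap T N"
    unfolding q_def T_def N_def
    using sub cA M F by (intro lyap_kron_list distinct_ks) (auto intro: pos_semidef_carrier)
  then have Q_kron: "Q_kron = kron Q1 N - kron P1 (lyap T N)"
    unfolding assms(20) q_prod ks_def[symmetric] by (simp add: N_def)
  have P_kron: "P_kron = kron P1 N" and R_kron: "R_kron = kron R1 N"
    unfolding assms(18,19) ks_def[symmetric] by (simp_all add: N_def)
  have B_kron: "B_kron = kron B1 (1\<^sub>m q)" and K_kron: "K_kron = kron K1 (1\<^sub>m q)"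
    unfolding assms(6,21) ks_def[symmetric] by (simp_all add: kron_list_one q_def)
  let ?Y = "A 1 + \<Delta>A 1 - B1 * K1"
  have BK1: "B1 * K1 \<in> carrier_mat (n 1) (n 1)" and AE1: "A 1 + \<Delta>A 1 \<in> carrier_mat (n 1) (n 1)"
    and Y: "?Y \<in> carrier_mat (n 1) (n 1)" and TT: "T + T' \<in> carrier_mat q q"
    using A1 E1 B1 cK1 cT cT' by auto
  have A_kron: "A_sum + \<Delta>A_sum = kron_sum (A 1 + \<Delta>A 1) (T + T')"
    unfolding assms(5,23) idx using kron_sum_add[OF A1 E1 cT cT'] by (simp add: T_def T'_def)
  have closed: "A_sum + \<Delta>A_sum - B_kron * K_kron = kron_sum ?Y (T + T')"
    unfolding A_kron B_kron K_kron kron_mult[OF B1 cK1 one_carrier_mat one_carrier_mat]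
    using kron_sum_minus_kron_one[OF AE1 BK1 TT] by simp
  let ?k = "n 1 * q"
  let ?L = "kron P1 (lyap T N)" and ?L' = "kron P1 (lyap T' N)"
  have cL: "?L \<in> carrier_mat ?k ?k" and cL': "?L' \<in> carrier_mat ?k ?k"
    using cP1 cT cT' cN by auto
  have KRK: "K_kron\<^sup>T * R_kron * K_kron = kron (K1\<^sup>T * R1 * K1) N"
  proof -
    have Kt: "K1\<^sup>T \<in> carrier_mat (n 1) p1" and KR: "K1\<^sup>T * R1 \<in> carrier_mat (n 1) p1" using cK1 cR1 by auto
    show ?thesis
      unfolding K_kron R_kron kron_transpose transpose_one
      using cN by (simp add: kron_mult[OF Kt cR1 one_carrier_mat cN] kron_mult[OF KR cK1 cN one_carrier_mat])
  qed
  have cKRK: "K1\<^sup>T * R1 * K1 \<in> carrier_mat (n 1) (n 1)" using cK1 cR1 by auto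
  have gap: "neg_semidef (n 1) (lyap ?Y P1 + Q1 + K1\<^sup>T * R1 * K1)"
  proof -
    have "pos_semidef (n 1) (U1 P1 - lyap (\<Delta>A 1) P1)"
      using assms(10)[OF assms(11) assms(22)[OF m1]] by (simp add: loewner_le_def lyap_def)
    moreover have "- (lyap (\<Delta>A 1) P1 - U1 P1) = U1 P1 - lyap (\<Delta>A 1) P1"
      using cU E1 cP1 by (intro eq_matI) (auto simp: lyap_def)
    ultimately show ?thesis
      unfolding riccati_closed_loop[OF A1 E1 B1 sP1 assms(8) cQ1 cU assms(12,13)] neg_semidef_def by simp
  qed
  have diss: "quad_form (lyap (A_sum + \<Delta>A_sum - B_kron * K_kron) P_kron + Q_kron + K_kron\<^sup>T * R_kron * K_kron) v \<le> 0"
    if v: "v \<in> carrier_vec ?k" for v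
  proof -
    let ?X1 = "kron (lyap ?Y P1) N" and ?X2 = "kron Q1 N" and ?X3 = "kron (K1\<^sup>T * R1 * K1) N"
    have cX: "?X1 \<in> carrier_mat ?k ?k" "?X2 \<in> carrier_mat ?k ?k" "?X3 \<in> carrier_mat ?k ?k"
      using Y cP1 cQ1 cKRK cN by auto
    have "lyap (A_sum + \<Delta>A_sum - B_kron * K_kron) P_kron = ?X1 + (?L + ?L')"
      unfolding closed P_kron lyap_kron_sum[OF Y cP1 TT cN] lyap_add[OF cT cT' cN]
      using kron_add_right[OF cP1 lyap_carrier[OF cT cN] lyap_carrier[OF cT' cN]] by simp
    then have "lyap (A_sum + \<Delta>A_sum - B_kron * K_kron) P_kron + Q_kron + K_kron\<^sup>T * R_kron * K_kron =
        (?X1 + (?L + ?L')) + (?X2 - ?L) + ?X3"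
      by (simp add: Q_kron KRK)
    \<comment> \<open>The nominal contribution \<open>?L\<close> of the factors from the second on cancels against the one in \<open>Q_kron\<close>.\<close>
    also have "\<dots> = (?X1 + ?X2 + ?X3) + ?L'"
      using cX cL cL' by (intro eq_matI) (auto simp: carrier_matD[OF cL'])
    also have "?X1 + ?X2 + ?X3 = kron (lyap ?Y P1 + Q1 + K1\<^sup>T * R1 * K1) N"
      using kron_add_left[OF lyap_carrier[OF Y cP1] cQ1 cN]
        kron_add_left[OF add_carrier_mat[OF cQ1] cKRK cN] by simp
    finally show ?thesis
      using neg_semidef_quad_form[OF neg_semidef_add[OF neg_semidef_kron_left[OF gap N]
        neg_semidef_kron_right[OF P1 S'] neg_semidef_carrier[OF neg_semidef_kron_left[OF gap N]] cL'] v]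
      by simp
  qed
  have psd_Q: "pos_semidef ?k Q_kron"
  proof -
    have "Q_kron = kron Q1 N + kron P1 (- lyap T N)"
      unfolding Q_kron kron_uminus
      using kron_carrier[OF cQ1 cN] cL by (simp add: minus_add_uminus_mat[of _ ?k ?k])
    then show ?thesis
      using pos_semidef_add[OF pos_semidef_kron[OF assms(7) N] pos_semidef_kron[OF P1, of q "- lyap T N"]] S
      by (simp add: neg_semidef_def)
  qed
  show ?thesis
  proof (rule state_feedback_cost_bound[of _ ?k _ "p1 * q" K_kron])
    show "A_sum + \<Delta>A_sum \<in> carrier_mat ?k ?k" unfolding A_kron using AE1 TT by simp
    show "B_kron \<in> carrier_mat ?k (p1 * q)" unfolding B_kron using B1 by simp
    show "K_kron \<in> carrier_mat (p1 * q) ?k" unfolding K_kron using cK1 by simp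
    show "pos_semidef ?k P_kron" unfolding P_kron by (rule pos_semidef_kron[OF P1 N])
    show "pos_semidef (p1 * q) R_kron" unfolding R_kron by (rule pos_semidef_kron[OF R1 N])
  qed (fact psd_Q assms(25,26) diss)+
qed

end
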